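(* Consider Dag-oriented ground terms over a language over the natural numbers in which: 1. $\theta$ is the only available growth-permitting function symbol; 2. the only built-in constant symbols are $C_0$, $C_1$ and $C_2$, representing $0$, $1$ and $2$; 3. the three function symbols for integer subtraction, integer division and the maximum operation are available. Then any integer $n$ can be encoded by a Dag-oriented ground term $G_n$ using only $O(\log n)$ logical symbols. Moreover, as the pointers needed to separate these $O(\log n)$ logical objects use $O(\log\log n)$ bits, the total amount of memory required for encoding such a Dag-oriented ground term is at most $O(\log n\cdot\log\log n)$ bits.
   Context: Integer subtraction $x-y$ equals $0$ if $x\le y$; integer division $x\div y$ equals $0$ if $y=0$ and $\lfloor x/y\rfloor$ otherwise; the maximum operation is binary. A function symbol $H(x_1,\dots,x_j)$ is *growth permitting* iff for each integer $k\ge2$ there is a tuple $(a_1,\dots,a_j)$ with each $a_i\le k$ and $H(a_1,\dots,a_j)>k$. The unary function symbol $\theta$ is constrained only by the following axioms, where $\mathrm{Power}(x)$ means that $x$ is a power of $2$ (including $1$): (1) $\forall x\,(\mathrm{Power}(x)\Rightarrow\mathrm{Power}(\theta(x)))$; (2) $\forall x\;\theta(x)\ne1$; (3) $\forall x\forall y\,([x\ne y\wedge\mathrm{Power}(x)]\Rightarrow\theta(x)\ne\theta(y))$; (4) $\forall x\,(\neg\mathrm{Power}(x)\Rightarrow\theta(x)=0)$. A *Dag-oriented ground term* is like an ordinary variable-free term, except that the usual tree structure is replaced by a directed acyclic graph: each node is labelled either by a constant symbol, or by a function symbol together with an ordered list of pointers to the nodes that are its arguments, so that one node may be used as an argument of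 several others; there is a designated output node. Its number of logical symbols is its number of nodes. It encodes $n$ if its output node has value $n$ for every function $\theta$ on the natural numbers satisfying the axioms above. The $O(\cdot)$ bounds are as $n\to\infty$. *)

theory Defs
  imports Complex_Main "HOL-Library.Landau_Symbols" "HOL-Library.Log_Nat" "HOL-Library.Sublist"
begin

definition power_of_two :: "nat \<Rightarrow> bool" where
  "power_of_two x \<longleftrightarrow> (\<exists>k. x = 2 ^ k)"

definition theta_axioms :: "(nat \<Rightarrow> nat) \<Rightarrow> bool" where
  "theta_axioms \<theta> \<longleftrightarrow>
     (\<forall>x. power_of_two x \<longrightarrow> power_of_two (\<theta> x)) \<and>
     (\<forall>x. \<theta> x \<noteq> 1) \<and>
     (\<forall>x y. x \<noteq> y \<and> power_of_two x \<longrightarrow> \<theta> x \<noteq> \<theta> y) \<and>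
     (\<forall>x. \<not> power_of_two x \<longrightarrow> \<theta> x = 0)"

definition growth_permitting :: "nat \<Rightarrow> (nat list \<Rightarrow> nat) \<Rightarrow> bool" where
  "growth_permitting j H \<longleftrightarrow>
     (\<forall>k\<ge>2. \<exists>as. length as = j \<and> (\<forall>a\<in>set as. a \<le> k) \<and> H as > k)"

section \<open>Languages\<close>

datatype constant_symbol = C0 | C1 | C2

text \<open>The four named symbols belong to every language; a language may add further function
  symbols \<open>Other f\<close>, each with a fixed interpretation on the natural numbers.\<close>

datatype 'f function_symbol = Theta | Subtraction | Division | Maximum | Other 'f

record 'f language =
  others :: "'f set"
  other_arity :: "'f \<Rightarrow> nat"
  other_fun :: "'f \<Rightarrow> nat list \<Rightarrow> nat"

definition function_symbols :: "'f language \<Rightarrow> 'f function_symbol set" where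
  "function_symbols L = {Theta, Subtraction, Division, Maximum} \<union> Other ` others L"

fun arity :: "'f language \<Rightarrow> 'f function_symbol \<Rightarrow> nat" where
  "arity L Theta = 1"
| "arity L Subtraction = 2"
| "arity L Division = 2"
| "arity L Maximum = 2"
| "arity L (Other f) = other_arity L f"

fun constant_value :: "constant_symbol \<Rightarrow> nat" where
  "constant_value C0 = 0"
| "constant_value C1 = 1"
| "constant_value C2 = 2"

text \<open>On \<^typ>\<open>nat\<close>, subtraction is truncated at \<open>0\<close>, and division is the floor of the quotient,
  with \<open>x div 0 = 0\<close>.\<close>

fun function_value :: "'f language \<Rightarrow> (nat \<Rightarrow> nat) \<Rightarrow> 'f function_symbol \<Rightarrow> nat list \<Rightarrow> nat" where
  "function_value L \<theta> Theta xs = \<theta> (xs ! 0)"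
| "function_value L \<theta> Subtraction xs = xs ! 0 - xs ! 1"
| "function_value L \<theta> Division xs = xs ! 0 div xs ! 1"
| "function_value L \<theta> Maximum xs = max (xs ! 0) (xs ! 1)"
| "function_value L \<theta> (Other f) xs = other_fun L f xs"

text \<open>The positivity condition excludes constants in the guise of function symbols without
  arguments.\<close>

definition theta_language :: "'f language \<Rightarrow> bool" where
  "theta_language L \<longleftrightarrow>
     (\<forall>f\<in>others L. other_arity L f > 0) \<and>
     (\<forall>\<theta>. theta_axioms \<theta> \<longrightarrow>
        (\<forall>f\<in>function_symbols L. growth_permitting (arity L f) (function_value L \<theta> f) \<longleftrightarrow> f = Theta))"

section \<open>Dag-oriented ground terms\<close>

text \<open>A pointer is a position in the list of nodes.\<close>

datatype 'f node = Const constant_symbol | Apply "'f function_symbol" "nat list"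

record 'f dag =
  nodes :: "'f node list"
  output_node :: nat

fun pointers :: "'f node \<Rightarrow> nat list" where
  "pointers (Const c) = []"
| "pointers (Apply f ps) = ps"

fun well_formed_node :: "'f language \<Rightarrow> nat \<Rightarrow> 'f node \<Rightarrow> bool" where
  "well_formed_node L N (Const c) \<longleftrightarrow> True"
| "well_formed_node L N (Apply f ps) \<longleftrightarrow>
     f \<in> function_symbols L \<and> length ps = arity L f \<and> (\<forall>p\<in>set ps. p < N)"

definition arcs :: "'f dag \<Rightarrow> (nat \<times> nat) set" where
  "arcs G = {(i, j). i < length (nodes G) \<and> j \<in> set (pointers (nodes G ! i))}"

definition dag_term :: "'f language \<Rightarrow> 'f dag \<Rightarrow> bool" where
  "dag_term L G \<longleftrightarrow>
     output_node G < length (nodes G) \<and>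
     (\<forall>v\<in>set (nodes G). well_formed_node L (length (nodes G)) v) \<and>
     acyclic (arcs G)"

inductive node_value :: "'f language \<Rightarrow> (nat \<Rightarrow> nat) \<Rightarrow> 'f dag \<Rightarrow> nat \<Rightarrow> nat \<Rightarrow> bool"
  for L :: "'f language" and \<theta> :: "nat \<Rightarrow> nat" and G :: "'f dag" where
  const_node: "i < length (nodes G) \<Longrightarrow> nodes G ! i = Const c \<Longrightarrow> node_value L \<theta> G i (constant_value c)"
| apply_node: "i < length (nodes G) \<Longrightarrow> nodes G ! i = Apply f ps \<Longrightarrow>
    list_all2 (node_value L \<theta> G) ps xs \<Longrightarrow> node_value L \<theta> G i (function_value L \<theta> f xs)"

definition encodes :: "'f language \<Rightarrow> 'f dag \<Rightarrow> nat \<Rightarrow> bool" where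
  "encodes L G n \<longleftrightarrow> (\<forall>\<theta>. theta_axioms \<theta> \<longrightarrow> node_value L \<theta> G (output_node G) n)"

definition num_symbols :: "'f dag \<Rightarrow> nat" where
  "num_symbols G = length (nodes G)"

section \<open>Memory\<close>

definition pointer_bits :: "'f dag \<Rightarrow> nat" where
  "pointer_bits G = ceillog2 (num_symbols G)"

definition pointer_code :: "nat \<Rightarrow> nat \<Rightarrow> bool list" where
  "pointer_code w p = map (bit p) [0..<w]"

type_synonym 'f symbol = "constant_symbol + 'f function_symbol"

definition symbols :: "'f language \<Rightarrow> 'f symbol set" where
  "symbols L = range Inl \<union> Inr ` function_symbols L"

fun symbol :: "'f node \<Rightarrow> 'f symbol" where
  "symbol (Const c) = Inl c"
| "symbol (Apply f ps) = Inr f"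

definition symbol_code :: "'f language \<Rightarrow> ('f symbol \<Rightarrow> bool list) \<Rightarrow> bool" where
  "symbol_code L cd \<longleftrightarrow> (\<forall>s\<in>symbols L. \<forall>t\<in>symbols L. prefix (cd s) (cd t) \<longrightarrow> s = t)"

definition node_code :: "('f symbol \<Rightarrow> bool list) \<Rightarrow> nat \<Rightarrow> 'f node \<Rightarrow> bool list" where
  "node_code cd w v = cd (symbol v) @ concat (map (pointer_code w) (pointers v))"

text \<open>The memory image of a dag: the pointer width in unary, which makes the rest decodable, then
  the pointer to the output node, then the nodes, each given by the code word of its symbol and its
  pointers in fixed width. Decodability is \<open>dag_code_inject\<close> below.\<close>

definition dag_code :: "('f symbol \<Rightarrow> bool list) \<Rightarrow> 'f dag \<Rightarrow> bool list" where
  "dag_code cd G =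
     (let w = pointer_bits G in
      replicate w True @ [False] @ pointer_code w (output_node G) @ concat (map (node_code cd w) (nodes G)))"

section \<open>Sanity checks\<close>

lemma theta_axioms_satisfiable: "\<exists>\<theta>. theta_axioms \<theta>"
proof
  show "theta_axioms (\<lambda>x. if power_of_two x then 2 * x else 0)"
    unfolding theta_axioms_def
  proof (intro conjI allI impI)
    fix x :: nat assume "power_of_two x"
    then obtain k where "x = 2 ^ k" by (auto simp: power_of_two_def)
    then have "2 * x = 2 ^ Suc k" by simp
    then have "power_of_two (2 * x)" unfolding power_of_two_def by blast
    with \<open>power_of_two x\<close> show "power_of_two (if power_of_two x then 2 * x else 0)" by simp
  qed (auto simp: power_of_two_def)
qed

lemma theta_growth_permitting:
  assumes "theta_axioms \<theta>"
  shows "growth_permitting 1 (function_value L \<theta> Theta)"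
proof -
  have "\<exists>a\<le>k. \<theta> a > k" if "k \<ge> 2" for k
  proof (rule ccontr)
    assume "\<not> ?thesis"
    then have le: "\<theta> a \<le> k" if "a \<le> k" for a using that by force
    let ?P = "{a. a \<le> k \<and> power_of_two a}"
    have fin: "finite ?P" by simp
    have "\<theta> ` ?P \<subseteq> ?P - {1}"
      using assms le unfolding theta_axioms_def by auto
    moreover have "inj_on \<theta> ?P"
      using assms unfolding theta_axioms_def inj_on_def by blast
    ultimately have "card ?P \<le> card (?P - {1})"
      by (metis (no_types, lifting) card_image card_mono fin finite_Diff)
    moreover have "1 \<in> ?P"
      using that by (auto simp: power_of_two_def intro: exI[of _ 0])
    ultimately show False
      using card_Diff1_less[OF fin] by fastforce
  qed
  then show ?thesis
    unfolding growth_permitting_def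
    by (metis One_nat_def empty_iff empty_set function_value.simps(1) length_Cons list.size(3)
        nth_Cons_0 set_ConsD)
qed

lemma theta_language_minimal:
  "theta_language \<lparr>others = {}, other_arity = ar, other_fun = I\<rparr>" (is "theta_language ?L")
proof -
  have two: "\<not> growth_permitting 2 H" if "\<And>a b k. a \<le> k \<Longrightarrow> b \<le> k \<Longrightarrow> H [a, b] \<le> k" for H
  proof -
    have "H as \<le> 2" if "length as = 2" "\<forall>a\<in>set as. a \<le> 2" for as
      using that \<open>\<And>a b k. a \<le> k \<Longrightarrow> b \<le> k \<Longrightarrow> H [a, b] \<le> k\<close>
      by (auto simp: numeral_2_eq_2 length_Suc_conv)
    then show ?thesis unfolding growth_permitting_def by (meson not_le order_refl)
  qed
  have "\<not> growth_permitting 2 (function_value ?L \<theta> f)"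
    if "f \<in> {Subtraction, Division, Maximum}" for f \<theta>
    using that by (intro two) (auto intro: order_trans[OF div_le_dividend])
  then show ?thesis
    using theta_growth_permitting[of _ ?L]
    unfolding theta_language_def function_symbols_def by auto
qed

lemma node_value_unique:
  assumes "node_value L \<theta> G i x" "node_value L \<theta> G i y"
  shows "x = y"
  using assms
proof (induction arbitrary: y rule: node_value.induct)
  case (const_node i c)
  from const_node(3) show ?case using const_node(1,2) by cases auto
next
  case (apply_node i f ps xs)
  from apply_node(4) obtain ys where ys: "y = function_value L \<theta> f ys"
      "list_all2 (node_value L \<theta> G) ps ys"
    using apply_node(2) by cases auto
  have "xs = ys"
    using apply_node(3) ys(2) by (auto simp: list_all2_conv_all_nth intro: nth_equalityI)
  with ys(1) show ?case by simp
qed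

lemma node_value_exists:
  assumes "dag_term L G" "i < length (nodes G)"
  shows "\<exists>x. node_value L \<theta> G i x"
proof -
  have "arcs G \<subseteq> {..<length (nodes G)} \<times> {..<length (nodes G)}"
  proof (clarsimp simp: arcs_def)
    fix i j assume "i < length (nodes G)" "j \<in> set (pointers (nodes G ! i))"
    then show "j < length (nodes G)"
      using assms(1) nth_mem[of i "nodes G"] unfolding dag_term_def
      by (cases "nodes G ! i") fastforce+
  qed
  then have sub: "arcs G \<subseteq> {..<length (nodes G)} \<times> {..<length (nodes G)}" .
  then have "finite (arcs G)" by (rule finite_subset) simp
  then have "wf ((arcs G)\<inverse>)"
    using assms(1) by (simp add: finite_acyclic_wf_converse dag_term_def)
  then show ?thesis
    using assms(2)
  proof (induction i rule: wf_induct_rule)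
    case (less i)
    show ?case
    proof (cases "nodes G ! i")
      case (Const c)
      then show ?thesis using less.prems node_value.const_node by blast
    next
      case (Apply f ps)
      have "\<exists>x. node_value L \<theta> G p x" if "p \<in> set ps" for p
      proof -
        have "(i, p) \<in> arcs G" using that Apply less.prems by (simp add: arcs_def)
        moreover from this have "p < length (nodes G)" using sub by blast
        ultimately show ?thesis using less.IH by blast
      qed
      then obtain h where "\<And>p. p \<in> set ps \<Longrightarrow> node_value L \<theta> G p (h p)" by metis
      then have "list_all2 (node_value L \<theta> G) ps (map h ps)"
        by (simp add: list_all2_conv_all_nth)
      then show ?thesis using less.prems Apply node_value.apply_node by blast
    qed
  qed
qed

lemma pointer_code_inject:
  assumes "pointer_code w p = pointer_code w q" "p < 2 ^ w" "q < 2 ^ w"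
  shows "p = q"
proof -
  have "bit p n = bit q n" for n
  proof (cases "n < w")
    case True
    then show ?thesis using assms(1) by (auto simp: pointer_code_def map_eq_conv)
  next
    case False
    then have "p < 2 ^ n" "q < 2 ^ n"
      using assms(2,3) by (meson less_le_trans not_less one_le_numeral power_increasing)+
    then show ?thesis by (simp add: bit_iff_odd)
  qed
  then show ?thesis by (simp add: bit_eq_iff)
qed

lemma length_pointer_code [simp]: "length (pointer_code w p) = w"
  by (simp add: pointer_code_def)

lemma pointer_codes_inject:
  assumes "length ps = length qs" "\<forall>p\<in>set ps. p < 2 ^ w" "\<forall>q\<in>set qs. q < 2 ^ w"
    "concat (map (pointer_code w) ps) @ xs = concat (map (pointer_code w) qs) @ ys"
  shows "ps = qs \<and> xs = ys"
  using assms
  by (induction ps qs rule: list_induct2) (auto dest: pointer_code_inject)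

lemma node_code_inject:
  assumes cd: "symbol_code L cd"
    and u: "well_formed_node L N u" and v: "well_formed_node L N v" and N: "N \<le> 2 ^ w"
    and eq: "node_code cd w u @ xs = node_code cd w v @ ys"
  shows "u = v \<and> xs = ys"
proof -
  have mem: "symbol u \<in> symbols L" "symbol v \<in> symbols L"
    using u v by (cases u; cases v; simp add: symbols_def)+
  have "prefix (cd (symbol u)) (cd (symbol v)) \<or> prefix (cd (symbol v)) (cd (symbol u))"
    using eq unfolding node_code_def append_assoc
    by (metis prefixI prefix_same_cases)
  then have sym: "symbol u = symbol v"
    using cd mem unfolding symbol_code_def by metis
  have "length (pointers u) = length (pointers v)"
    using sym u v by (cases u; cases v) auto
  moreover have "\<forall>p\<in>set (pointers u). p < 2 ^ w" "\<forall>p\<in>set (pointers v). p < 2 ^ w"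
    using u v N by (cases u; cases v; fastforce)+
  moreover have "concat (map (pointer_code w) (pointers u)) @ xs =
      concat (map (pointer_code w) (pointers v)) @ ys"
    using eq sym by (simp add: node_code_def)
  ultimately have "pointers u = pointers v \<and> xs = ys" by (rule pointer_codes_inject)
  then show ?thesis using sym by (cases u; cases v) auto
qed

lemma node_code_nonempty:
  assumes "symbol_code L cd" "well_formed_node L N v"
  shows "node_code cd w v \<noteq> []"
proof
  assume "node_code cd w v = []"
  then have e: "cd (symbol v) = []" by (simp add: node_code_def)
  have "symbol v \<in> symbols L" using assms(2) by (cases v) (auto simp: symbols_def)
  moreover have "Inl C0 \<in> symbols L" "Inl C1 \<in> symbols L" by (auto simp: symbols_def)
  ultimately have "symbol v = Inl C0" "symbol v = Inl C1"
    using assms(1) e unfolding symbol_code_def by force+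
  then show False by simp
qed

lemma node_codes_inject:
  assumes "symbol_code L cd" "N \<le> 2 ^ w" "M \<le> 2 ^ w"
    "\<forall>u\<in>set us. well_formed_node L N u" "\<forall>v\<in>set vs. well_formed_node L M v"
    "concat (map (node_code cd w) us) = concat (map (node_code cd w) vs)"
  shows "us = vs"
  using assms(4-)
proof (induction us arbitrary: vs)
  case Nil
  then show ?case using node_code_nonempty[OF assms(1)] by (cases vs) fastforce+
next
  case (Cons u us)
  show ?case
  proof (cases vs)
    case Nil
    then show ?thesis using Cons.prems node_code_nonempty[OF assms(1)] by fastforce
  next
    case (Cons v vs')
    have mono: "well_formed_node L K x \<Longrightarrow> K \<le> 2 ^ w \<Longrightarrow> well_formed_node L (2 ^ w) x" for K x
      by (cases x) auto
    have "u = v \<and> concat (map (node_code cd w) us) = concat (map (node_code cd w) vs')"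
      using Cons.prems Cons assms(2,3) mono
      by (intro node_code_inject[OF assms(1), of "2 ^ w" u v w]) auto
    then show ?thesis using Cons.IH[of vs'] Cons.prems Cons by simp
  qed
qed

lemma num_symbols_le_power: "num_symbols G \<le> 2 ^ pointer_bits G"
proof (cases "num_symbols G = 0")
  case False
  then have pos: "real (num_symbols G) \<ge> 1" by simp
  have "real (num_symbols G) = 2 powr log 2 (real (num_symbols G))" using pos by simp
  also have "\<dots> \<le> 2 powr real (pointer_bits G)"
    using pos by (intro powr_mono) (auto simp: pointer_bits_def ceillog2_def)
  also have "\<dots> = real (2 ^ pointer_bits G)" by (simp add: powr_realpow)
  finally show ?thesis by linarith
qed simp

lemma dag_code_inject:
  assumes "symbol_code L cd" "dag_term L G" "dag_term L H" "dag_code cd G = dag_code cd H"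
  shows "G = (H :: 'f dag)"
proof -
  have un: "replicate v True @ False # xs = replicate w True @ False # ys \<Longrightarrow> v = w \<and> xs = ys"
    for v w xs ys
  proof (induction v arbitrary: w)
    case 0
    then show ?case by (cases w) auto
  next
    case (Suc v)
    then show ?case by (cases w) auto
  qed
  define w where "w = pointer_bits G"
  have wH: "pointer_bits H = w" and
    "pointer_code w (output_node G) @ concat (map (node_code cd w) (nodes G)) =
     pointer_code w (output_node H) @ concat (map (node_code cd w) (nodes H))"
    using un assms(4) unfolding dag_code_def Let_def w_def by (fastforce simp del: append_eq_append_conv)+
  then have p: "pointer_code w (output_node G) = pointer_code w (output_node H)"
    and q: "concat (map (node_code cd w) (nodes G)) = concat (map (node_code cd w) (nodes H))"
    by simp_all
  have G: "length (nodes G) \<le> 2 ^ w" using num_symbols_le_power[of G] by (simp add: num_symbols_def w_def)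
  have H: "length (nodes H) \<le> 2 ^ w" using num_symbols_le_power[of H] wH by (simp add: num_symbols_def)
  have "output_node G = output_node H"
    using p G H assms(2,3) by (intro pointer_code_inject[of w]) (auto simp: dag_term_def)
  moreover have "nodes G = nodes H"
    using assms(2,3) by (intro node_codes_inject[OF assms(1) G H _ _ q]) (auto simp: dag_term_def)
  ultimately show ?thesis by simp
qed

end

theory Submission
  imports Defs "HOL-Real_Asymp.Real_Asymp"
begin

text \<open>
  Although \<open>\<theta>\<close> is not determined by its axioms, the iterates \<open>1, \<theta> 1, \<theta> (\<theta> 1), \<dots>\<close> are pairwise
  distinct powers of two: \<open>\<theta>\<close> is injective on powers of two and never returns to \<open>1\<close>. Distinctness
  alone forces growth, because the largest of \<open>m + 1\<close> distinct powers of two is at least \<open>2 ^ m\<close>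
  (\<open>two_power_le_Max_iterates\<close>). With \<open>m\<close> the number of binary digits of \<open>n\<close>, a dag with \<open>O(m)\<close>
  nodes therefore has a node of some unknown value \<open>B \<ge> n\<close>.

  Such an upper bound turns subtraction into addition: \<open>x + y = B - ((B - x) - y)\<close> as soon as
  \<open>x + y \<le> B\<close>, whatever \<open>B\<close> is. Hence \<open>2 * x + b = B - (((B - x) - x) - b)\<close>, and Horner's scheme on
  the binary digits \<open>b\<close> of \<open>n\<close> builds \<open>n\<close> with four more nodes per digit
  (\<open>last_values_binary_numeral\<close>). The value of the output node is \<open>n\<close> for every \<open>\<theta>\<close>, although
  the values of the intermediate nodes do depend on \<open>\<theta>\<close>.

  The dag has \<open>6 * m + 4\<close> nodes, of which each costs one code word, taken from a finite set of
  symbols that does not depend on \<open>n\<close>, and at most two pointers of \<open>O(log m)\<close> bits. This gives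
  the three bounds.
\<close>

section \<open>Growth of the iterates of \<open>\<theta>\<close>\<close>

lemma power_of_two_iterate:
  assumes "theta_axioms \<theta>"
  shows "power_of_two ((\<theta> ^^ i) 1)"
proof (induction i)
  case 0
  show ?case by (auto simp: power_of_two_def intro: exI[of _ 0])
next
  case (Suc i)
  then show ?case using assms by (simp add: theta_axioms_def)
qed

text \<open>Injectivity of \<open>\<theta>\<close> on powers of two lets a coincidence between two iterates be traced back
  to one with the start of the orbit, and \<open>1\<close> is not a value of \<open>\<theta>\<close>.\<close>

lemma iterate_neq:
  assumes "theta_axioms \<theta>" "i < j"
  shows "(\<theta> ^^ i) 1 \<noteq> (\<theta> ^^ j) 1"
  using assms(2)
proof (induction i arbitrary: j)
  case 0
  then obtain k where "j = Suc k" by (cases j) auto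
  moreover have "\<theta> ((\<theta> ^^ k) 1) \<noteq> 1" using assms(1) unfolding theta_axioms_def by blast
  ultimately show ?case by simp
next
  case (Suc i)
  then obtain k where k: "j = Suc k" "i < k" by (cases j) auto
  have "(\<theta> ^^ i) 1 \<noteq> (\<theta> ^^ k) 1" using Suc.IH[OF k(2)] .
  then have "\<theta> ((\<theta> ^^ i) 1) \<noteq> \<theta> ((\<theta> ^^ k) 1)"
    using assms(1) power_of_two_iterate[OF assms(1)] unfolding theta_axioms_def by blast
  then show ?case by (simp add: k(1))
qed

text \<open>By the pigeonhole principle: \<open>m + 1\<close> distinct exponents cannot all be below \<open>m\<close>.\<close>

lemma two_power_le_Max_iterates:
  assumes "theta_axioms \<theta>"
  shows "2 ^ m \<le> (MAX i\<in>{..m}. (\<theta> ^^ i) 1)"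
proof -
  obtain e where e: "(\<theta> ^^ i) 1 = 2 ^ e i" for i
    using power_of_two_iterate[OF assms] unfolding power_of_two_def by metis
  have "inj e"
  proof (rule linorder_injI)
    fix i j :: nat assume "i < j"
    then show "e i \<noteq> e j" using iterate_neq[OF assms] e by metis
  qed
  then have "card (e ` {..m}) = Suc m"
    by (metis card_atMost card_image inj_on_subset subset_UNIV)
  then have "\<not> e ` {..m} \<subseteq> {..<m}"
    by (metis card_lessThan card_mono finite_lessThan not_less_eq_eq order_refl)
  then obtain i where "i \<le> m" "m \<le> e i" by (force simp: image_subset_iff)
  then have "2 ^ m \<le> (\<theta> ^^ i) 1" by (simp add: e del: One_nat_def)
  also have "\<dots> \<le> (MAX i\<in>{..m}. (\<theta> ^^ i) 1)"
    using \<open>i \<le> m\<close> by (intro Max_ge) auto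
  finally show ?thesis .
qed

section \<open>Straight-line programs\<close>

text \<open>A list of nodes whose pointers all point backwards is a straight-line program. It is a dag
  already sorted topologically, so that its nodes can be evaluated from left to right.\<close>

definition straight_line :: "'f language \<Rightarrow> 'f node list \<Rightarrow> bool" where
  "straight_line L ns \<longleftrightarrow> (\<forall>i<length ns. well_formed_node L i (ns ! i))"

fun value_from :: "'f language \<Rightarrow> (nat \<Rightarrow> nat) \<Rightarrow> nat list \<Rightarrow> 'f node \<Rightarrow> nat" where
  "value_from L \<theta> vs (Const c) = constant_value c"
| "value_from L \<theta> vs (Apply f ps) = function_value L \<theta> f (map (nth vs) ps)"

definition "values" :: "'f language \<Rightarrow> (nat \<Rightarrow> nat) \<Rightarrow> 'f node list \<Rightarrow> nat list" where
  "values L \<theta> = foldl (\<lambda>vs v. vs @ [value_from L \<theta> vs v]) []"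

lemma values_Nil [simp]: "values L \<theta> [] = []"
  by (simp add: values_def)

lemma values_snoc: "values L \<theta> (ns @ [v]) = values L \<theta> ns @ [value_from L \<theta> (values L \<theta> ns) v]"
  by (simp add: values_def)

lemma length_values [simp]: "length (values L \<theta> ns) = length ns"
  by (induction ns rule: rev_induct) (simp_all add: values_snoc)

lemma values_append_nth: "i < length ns \<Longrightarrow> values L \<theta> (ns @ ms) ! i = values L \<theta> ns ! i"
proof (induction ms rule: rev_induct)
  case (snoc v ms)
  then show ?case
    using values_snoc[of L \<theta> "ns @ ms" v] by (simp add: nth_append)
qed simp

lemma straight_line_snoc [simp]:
  "straight_line L (ns @ [v]) \<longleftrightarrow> straight_line L ns \<and> well_formed_node L (length ns) v"
  by (auto simp: straight_line_def nth_append less_Suc_eq)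

lemma well_formed_node_mono: "well_formed_node L N v \<Longrightarrow> N \<le> M \<Longrightarrow> well_formed_node L M v"
  by (cases v) auto

lemma pointer_less: "well_formed_node L N v \<Longrightarrow> p \<in> set (pointers v) \<Longrightarrow> p < N"
  by (cases v) auto

lemma dag_term_straight_line:
  assumes "straight_line L ns" "k < length ns"
  shows "dag_term L \<lparr>nodes = ns, output_node = k\<rparr>"
proof -
  let ?G = "\<lparr>nodes = ns, output_node = k\<rparr>"
  have "arcs ?G \<subseteq> less_than\<inverse>"
    using assms(1) pointer_less by (fastforce simp: arcs_def straight_line_def)
  moreover have "acyclic (less_than\<inverse>)"
    by (simp add: acyclic_converse wf_acyclic)
  ultimately have "acyclic (arcs ?G)" by (rule acyclic_subset[rotated])
  moreover have "well_formed_node L (length ns) v" if "v \<in> set ns" for v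
    using assms(1) that well_formed_node_mono
    by (metis in_set_conv_nth less_imp_le straight_line_def)
  ultimately show ?thesis using assms(2) by (simp add: dag_term_def)
qed

text \<open>Evaluation from left to right only reads values that are already final, which is why it agrees
  with the values of the dag.\<close>

lemma values_nth:
  assumes "straight_line L ns" "i < length ns"
  shows "values L \<theta> ns ! i = value_from L \<theta> (values L \<theta> ns) (ns ! i)"
  using assms
proof (induction ns rule: rev_induct)
  case (snoc v ns)
  have same: "value_from L \<theta> (values L \<theta> (ns @ [v])) u = value_from L \<theta> (values L \<theta> ns) u"
    if "\<forall>p\<in>set (pointers u). p < length ns" for u
  proof (cases u)
    case (Apply f ps)
    then have "map (nth (values L \<theta> (ns @ [v]))) ps = map (nth (values L \<theta> ns)) ps"
      using that by (simp add: values_append_nth)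
    then show ?thesis using Apply by (simp only: value_from.simps)
  qed simp
  show ?case
  proof (cases "i < length ns")
    case True
    then have "well_formed_node L i (ns ! i)"
      using snoc.prems(1) by (simp add: straight_line_def[of L ns])
    then have "\<forall>p\<in>set (pointers (ns ! i)). p < length ns"
      using pointer_less True less_trans by blast
    then show ?thesis
      using snoc.IH snoc.prems(1) True same[of "ns ! i"]
      by (simp add: values_append_nth nth_append del: value_from.simps)
  next
    case False
    then have "i = length ns" using snoc.prems(2) by simp
    moreover have "\<forall>p\<in>set (pointers v). p < length ns"
      using snoc.prems(1) pointer_less by auto
    ultimately show ?thesis
      using same[of v] values_snoc[of L \<theta> ns v] by (simp add: nth_append del: value_from.simps)
  qed
qed simp

lemma node_value_straight_line:
  assumes "straight_line L ns" "i < length ns"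
  shows "node_value L \<theta> \<lparr>nodes = ns, output_node = k\<rparr> i (values L \<theta> ns ! i)"
  using assms(2)
proof (induction i rule: less_induct)
  case (less i)
  let ?G = "\<lparr>nodes = ns, output_node = k\<rparr>"
  note val = values_nth[OF assms(1) less.prems, of \<theta>]
  show ?case
  proof (cases "ns ! i")
    case (Const c)
    then show ?thesis using node_value.const_node[of i ?G c L \<theta>] less.prems val by simp
  next
    case (Apply f ps)
    have "p < i" if "p \<in> set ps" for p
      using assms(1) less.prems Apply that by (auto simp: straight_line_def)
    then have "list_all2 (node_value L \<theta> ?G) ps (map (nth (values L \<theta> ns)) ps)"
      using less by (auto simp: list_all2_conv_all_nth)
    then show ?thesis
      using node_value.apply_node[of i ?G f ps L \<theta>] less.prems Apply val by simp
  qed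
qed

lemma encodes_straight_line:
  assumes "straight_line L ns" "ns \<noteq> []"
    and "\<And>\<theta>. theta_axioms \<theta> \<Longrightarrow> last (values L \<theta> ns) = n"
  shows "encodes L \<lparr>nodes = ns, output_node = length ns - 1\<rparr> n"
  unfolding encodes_def
proof (intro allI impI)
  fix \<theta> :: "nat \<Rightarrow> nat" assume "theta_axioms \<theta>"
  then have "values L \<theta> ns ! (length ns - 1) = n"
    using assms(2,3) by (metis last_conv_nth length_0_conv length_values)
  then show "node_value L \<theta> \<lparr>nodes = ns, output_node = length ns - 1\<rparr>
      (output_node \<lparr>nodes = ns, output_node = length ns - 1\<rparr>) n"
    using node_value_straight_line[OF assms(1), of "length ns - 1" \<theta> "length ns - 1"] assms(2)
    by simp
qed

section \<open>A large value\<close>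

text \<open>Positions \<open>0\<close> and \<open>1\<close> hold the two binary digits, so that each digit is its own pointer.
  Position \<open>2 * m + 1\<close> holds the iterate \<open>\<theta>\<^sup>m 1\<close> and position \<open>2 * m + 2\<close> the maximum of the
  iterates up to it; for \<open>m = 0\<close> both are \<open>1\<close>.\<close>

primrec iterate_maximum :: "nat \<Rightarrow> 'f node list" where
  "iterate_maximum 0 = [Const C0, Const C1, Const C1]"
| "iterate_maximum (Suc m) =
     iterate_maximum m @ [Apply Theta [2 * m + 1], Apply Maximum [2 * m + 2, 2 * m + 3]]"

lemma length_iterate_maximum [simp]: "length (iterate_maximum m) = 2 * m + 3"
  by (induction m) auto

lemma function_symbols_basic [simp]:
  "Theta \<in> function_symbols L" "Subtraction \<in> function_symbols L" "Maximum \<in> function_symbols L"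
  by (simp_all add: function_symbols_def)

lemma straight_line_iterate_maximum: "straight_line L (iterate_maximum m)"
proof (induction m)
  case 0
  show ?case by (auto simp: straight_line_def nth_Cons split: nat.split)
next
  case (Suc m)
  have "straight_line L ((iterate_maximum m @ [Apply Theta [2 * m + 1]]) @
      [Apply Maximum [2 * m + 2, 2 * m + 3]])"
    using Suc by (simp only: straight_line_snoc) auto
  then show ?case by simp
qed

lemma values_iterate_maximum:
  fixes L :: "'f language" and m :: nat and \<theta> :: "nat \<Rightarrow> nat"
  defines "vs \<equiv> values L \<theta> (iterate_maximum m)"
  shows "vs ! 0 = 0" "vs ! 1 = 1" "vs ! (2 * m + 1) = (\<theta> ^^ m) 1"
    "vs ! (2 * m + 2) = (MAX i\<in>{..m}. (\<theta> ^^ i) 1)"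
proof -
  have "vs ! 0 = 0 \<and> vs ! 1 = 1 \<and> vs ! (2 * m + 1) = (\<theta> ^^ m) 1 \<and>
    vs ! (2 * m + 2) = (MAX i\<in>{..m}. (\<theta> ^^ i) 1)"
    unfolding vs_def
  proof (induction m)
    case 0
    show ?case by (simp add: values_def)
  next
    case (Suc m)
    define ns :: "'f node list" where "ns = iterate_maximum m"
    define t where "t = (\<theta> ^^ Suc m) 1"
    define M where "M = (MAX i\<in>{..m}. (\<theta> ^^ i) 1)"
    have len: "length (values L \<theta> ns) = 2 * m + 3" by (simp add: ns_def)
    have vs1: "values L \<theta> (ns @ [Apply Theta [2 * m + 1]]) = values L \<theta> ns @ [t]"
      using Suc by (simp add: values_snoc ns_def t_def)
    have "values L \<theta> (iterate_maximum (Suc m)) =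
        values L \<theta> ((ns @ [Apply Theta [2 * m + 1]]) @ [Apply Maximum [2 * m + 2, 2 * m + 3]])"
      by (simp add: ns_def)
    also have "\<dots> = values L \<theta> ns @ [t, max M t]"
      unfolding values_snoc[of L \<theta> "ns @ _"] vs1
      using Suc len by (simp add: nth_append ns_def M_def)
    finally have eq: "values L \<theta> (iterate_maximum (Suc m)) = values L \<theta> ns @ [t, max M t]" .
    have "(MAX i\<in>{..Suc m}. (\<theta> ^^ i) 1) = max M t"
      by (simp add: atMost_Suc t_def M_def max.commute)
    then show ?case
      using Suc len unfolding eq by (simp add: nth_append ns_def[symmetric] t_def)
  qed
  then show "vs ! 0 = 0" "vs ! 1 = 1" "vs ! (2 * m + 1) = (\<theta> ^^ m) 1"
    "vs ! (2 * m + 2) = (MAX i\<in>{..m}. (\<theta> ^^ i) 1)" by blast+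
qed

section \<open>Binary numerals by subtraction\<close>

text \<open>Horner's scheme with the step \<open>x \<mapsto> B - (((B - x) - x) - b)\<close>, where \<open>x\<close> is the value of the
  last node of the program so far, \<open>B\<close> is the value at position \<open>p\<close>, and the digit \<open>b\<close> is read at
  position \<open>b\<close>.\<close>

fun binary_numeral :: "nat \<Rightarrow> 'f node list \<Rightarrow> nat \<Rightarrow> 'f node list" where
  "binary_numeral p ns n =
     (if n = 0 then ns @ [Const C0]
      else let ms = binary_numeral p ns (n div 2); l = length ms in
        ms @ [Apply Subtraction [p, l - 1], Apply Subtraction [l, l - 1],
              Apply Subtraction [l + 1, n mod 2], Apply Subtraction [p, l + 2]])"

declare binary_numeral.simps [simp del]

lemma binary_numeral_0 [simp]: "binary_numeral p ns 0 = ns @ [Const C0]"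
  by (simp add: binary_numeral.simps)

lemma binary_numeral_rec:
  assumes "n > 0" "length (binary_numeral p ns (n div 2)) = Suc k"
  shows "binary_numeral p ns n =
    (((binary_numeral p ns (n div 2) @ [Apply Subtraction [p, k]]) @
      [Apply Subtraction [Suc k, k]]) @ [Apply Subtraction [Suc (Suc k), n mod 2]]) @
      [Apply Subtraction [p, Suc (Suc (Suc k))]]"
  using assms by (subst binary_numeral.simps) (simp add: Let_def)

lemma length_binary_numeral: "length (binary_numeral p ns n) = length ns + 1 + 4 * floorlog 2 n"
proof (induction n rule: less_induct)
  case (less n)
  show ?case
  proof (cases "n = 0")
    case True
    then show ?thesis by (simp add: floorlog_def)
  next
    case False
    then have "floorlog 2 n = floorlog 2 (n div 2) + 1" by (simp add: compute_floorlog)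
    then show ?thesis
      using less[of "n div 2"] False by (subst binary_numeral.simps) (simp add: Let_def)
  qed
qed

lemma straight_line_binary_numeral:
  assumes "straight_line L ns" "p < length ns" "2 \<le> length ns"
  shows "straight_line L (binary_numeral p ns n)"
proof (induction n rule: less_induct)
  case (less n)
  show ?case
  proof (cases "n = 0")
    case True
    then show ?thesis using assms(1) by simp
  next
    case False
    let ?ms = "binary_numeral p ns (n div 2)"
    obtain k where k: "length ?ms = Suc k" "length ns \<le> k"
      using length_binary_numeral[of p ns "n div 2"] by simp
    have "n mod 2 < length ns" using assms(3) by (meson less_le_trans mod_less_divisor pos2)
    moreover have "straight_line L ?ms" using less False by simp
    ultimately show ?thesis
      unfolding binary_numeral_rec[OF False[unfolded neq0_conv] k(1)] straight_line_snoc
      using k assms(2) by (auto simp: less_Suc_eq)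
  qed
qed

lemma values_binary_numeral_nth:
  assumes "i < length ns"
  shows "values L \<theta> (binary_numeral p ns n) ! i = values L \<theta> ns ! i"
proof -
  have "\<exists>ms. binary_numeral p ns n = ns @ ms"
  proof (induction n rule: less_induct)
    case (less n)
    show ?case
    proof (cases "n = 0")
      case False
      then obtain ms where "binary_numeral p ns (n div 2) = ns @ ms" using less[of "n div 2"] by auto
      with False show ?thesis by (simp add: binary_numeral.simps[of p ns n] Let_def)
    qed simp
  qed
  then show ?thesis using values_append_nth[OF assms] by metis
qed

text \<open>The numbers met on the way are the prefixes \<open>n div 2 ^ j\<close> of the numeral. They are at most
  \<open>n\<close>, so a single upper bound of \<open>n\<close> keeps every subtraction from being truncated.\<close>

lemma last_values_binary_numeral:
  assumes "p < length ns" "2 \<le> length ns" "values L \<theta> ns ! 0 = 0" "values L \<theta> ns ! 1 = 1"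
    and "n \<le> values L \<theta> ns ! p"
  shows "last (values L \<theta> (binary_numeral p ns n)) = n"
  using assms(5)
proof (induction n rule: less_induct)
  case (less n)
  show ?case
  proof (cases "n = 0")
    case True
    then show ?thesis by (simp add: values_snoc)
  next
    case False
    define ms where "ms = binary_numeral p ns (n div 2)"
    define vs where "vs = values L \<theta> ms"
    define B where "B = values L \<theta> ns ! p"
    define x where "x = n div 2"
    define b where "b = n mod 2"
    obtain k where k: "length ms = Suc k" "length ns \<le> k"
      using length_binary_numeral[of p ns "n div 2"] by (simp add: ms_def)
    have len: "length vs = Suc k" using k by (simp add: vs_def)
    have "last vs = x" using less False by (simp add: ms_def vs_def x_def)
    then have x: "vs ! k = x" using len by (metis diff_Suc_1 last_conv_nth length_0_conv nat.distinct(1))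
    have B: "vs ! p = B"
      using values_binary_numeral_nth[OF assms(1)] by (simp add: vs_def ms_def B_def)
    have "b < length ns" using assms(2) unfolding b_def by (meson less_le_trans mod_less_divisor pos2)
    then have "vs ! b = values L \<theta> ns ! b"
      using values_binary_numeral_nth by (simp add: vs_def ms_def)
    moreover have "b = 0 \<or> b = 1" by (auto simp: b_def)
    ultimately have b: "vs ! b = b" using assms(3,4) by auto
    have lt: "p < Suc k" "b < Suc k" using assms(1) \<open>b < length ns\<close> k(2) by simp_all
    have eq: "binary_numeral p ns n =
        (((ms @ [Apply Subtraction [p, k]]) @ [Apply Subtraction [Suc k, k]]) @
        [Apply Subtraction [Suc (Suc k), b]]) @ [Apply Subtraction [p, Suc (Suc (Suc k))]]"
      using binary_numeral_rec[of n p ns k] False k(1) by (simp only: ms_def b_def)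
    have "values L \<theta> (binary_numeral p ns n) =
        vs @ [B - x, B - x - x, B - x - x - b, B - (B - x - x - b)]"
      unfolding eq values_snoc vs_def[symmetric]
      using x B b lt len by (simp add: nth_append b_def[symmetric] less_Suc_eq)
    moreover have "n = 2 * x + b" by (simp add: x_def b_def)
    ultimately show ?thesis using less.prems by (simp add: B_def)
  qed
qed

section \<open>The encoding and its size\<close>

definition encoding_nodes :: "nat \<Rightarrow> 'f node list" where
  "encoding_nodes n = binary_numeral (2 * floorlog 2 n + 2) (iterate_maximum (floorlog 2 n)) n"

definition encoding :: "nat \<Rightarrow> 'f dag" where
  "encoding n = \<lparr>nodes = encoding_nodes n, output_node = length (encoding_nodes n :: 'f node list) - 1\<rparr>"

lemma length_encoding_nodes: "length (encoding_nodes n) = 6 * floorlog 2 n + 4"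
  by (simp add: encoding_nodes_def length_binary_numeral)

lemma num_symbols_encoding: "num_symbols (encoding n) = 6 * floorlog 2 n + 4"
  by (simp add: num_symbols_def encoding_def length_encoding_nodes)

lemma straight_line_encoding_nodes: "straight_line L (encoding_nodes n)"
  unfolding encoding_nodes_def
  by (intro straight_line_binary_numeral straight_line_iterate_maximum) auto

lemma dag_term_encoding: "dag_term L (encoding n)"
  unfolding encoding_def
  by (intro dag_term_straight_line straight_line_encoding_nodes) (simp add: length_encoding_nodes)

lemma le_two_power_floorlog: "n \<le> 2 ^ floorlog 2 n"
  using floorlog_bounds[of n 2] by (cases "n = 0") auto

lemma encodes_encoding: "encodes L (encoding n) n"
  unfolding encoding_def
proof (rule encodes_straight_line[OF straight_line_encoding_nodes])
  show "encoding_nodes n \<noteq> []" by (metis length_encoding_nodes add_is_0 list.size(3) zero_neq_numeral)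
next
  fix \<theta> :: "nat \<Rightarrow> nat" assume "theta_axioms \<theta>"
  then have "n \<le> (MAX i\<in>{..floorlog 2 n}. (\<theta> ^^ i) 1)"
    using le_two_power_floorlog two_power_le_Max_iterates order_trans by blast
  then show "last (values L \<theta> (encoding_nodes n)) = n"
    unfolding encoding_nodes_def
    using values_iterate_maximum[where L = L and \<theta> = \<theta> and m = "floorlog 2 n"]
    by (intro last_values_binary_numeral) simp_all
qed

text \<open>No node of the encoding has more than two arguments or a symbol outside a fixed finite set,
  which bounds the cost of each node independently of \<open>n\<close>.\<close>

definition small_node :: "'f node \<Rightarrow> bool" where
  "small_node v \<longleftrightarrow> length (pointers v) \<le> 2 \<and>
     symbol v \<in> {Inl C0, Inl C1, Inr Theta, Inr Subtraction, Inr Maximum}"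

lemma small_encoding_nodes: "\<forall>v\<in>set (encoding_nodes n :: 'f node list). small_node v"
proof -
  have "\<forall>v\<in>set (iterate_maximum m :: 'f node list). small_node v" for m
    by (induction m) (auto simp: small_node_def)
  moreover have "\<forall>v\<in>set (binary_numeral p ns k). small_node v"
    if "\<forall>v\<in>set ns. small_node v" for p k and ns :: "'f node list"
  proof (induction k rule: less_induct)
    case (less k)
    have "\<forall>v\<in>set (binary_numeral p ns (k div 2)). small_node v" if "k \<noteq> 0"
      using less[of "k div 2"] that by simp
    then show ?case
      using that
      by (cases "k = 0") (auto simp: binary_numeral.simps[of p ns k] Let_def small_node_def)
  qed
  ultimately show ?thesis unfolding encoding_nodes_def by blast
qed

lemma length_dag_code_encoding_le:
  fixes cd :: "'f symbol \<Rightarrow> bool list"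
  obtains c where "\<And>n. length (dag_code cd (encoding n)) \<le>
    2 * pointer_bits (encoding n :: 'f dag) + 1 +
    num_symbols (encoding n :: 'f dag) * (c + 2 * pointer_bits (encoding n :: 'f dag))"
proof
  let ?S = "{Inl C0, Inl C1, Inr Theta, Inr Subtraction, Inr Maximum} :: 'f symbol set"
  define c where "c = (\<Sum>s\<in>?S. length (cd s))"
  fix n
  define G :: "'f dag" where "G = encoding n"
  define w where "w = pointer_bits G"
  have node: "length (node_code cd w v) \<le> c + 2 * w" if "v \<in> set (nodes G)" for v
  proof -
    have v: "length (pointers v) \<le> 2" "symbol v \<in> ?S"
      using that small_encoding_nodes unfolding G_def encoding_def small_node_def
      by (metis dag.select_convs(1))+
    have "length (cd (symbol v)) \<le> c"
      unfolding c_def by (rule member_le_sum[OF v(2)]) simp_all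
    moreover have "length (concat (map (pointer_code w) (pointers v))) = length (pointers v) * w"
      by (simp add: length_concat comp_def sum_list_triv)
    ultimately show ?thesis using v(1) by (simp add: node_code_def add_mono)
  qed
  have "length (concat (map (node_code cd w) (nodes G))) = (\<Sum>v\<leftarrow>nodes G. length (node_code cd w v))"
    by (simp add: length_concat comp_def)
  also have "\<dots> \<le> (\<Sum>v\<leftarrow>nodes G. c + 2 * w)"
    using node by (intro sum_list_mono)
  also have "\<dots> = num_symbols G * (c + 2 * w)"
    by (simp add: sum_list_triv num_symbols_def)
  finally show "length (dag_code cd (encoding n)) \<le>
    2 * pointer_bits (encoding n :: 'f dag) + 1 +
    num_symbols (encoding n :: 'f dag) * (c + 2 * pointer_bits (encoding n :: 'f dag))"
    unfolding G_def[symmetric] w_def[symmetric]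
    by (simp add: dag_code_def Let_def w_def[symmetric])
qed

lemma bigo_of_le:
  fixes f :: "nat \<Rightarrow> nat" and g :: "nat \<Rightarrow> real"
  assumes "\<And>n. n > 0 \<Longrightarrow> real (f n) \<le> g n"
  shows "(\<lambda>n. real (f n)) \<in> O(g)"
proof (rule landau_o.big_mono, rule eventually_mono[OF eventually_gt_at_top[of 0]])
  fix n :: nat assume "0 < n"
  then show "norm (real (f n)) \<le> norm (g n)" using assms[of n] by simp
qed

lemma num_symbols_encoding_le:
  assumes "n > 0"
  shows "real (num_symbols (encoding n)) \<le> 6 * log 2 (real n) + 10"
proof -
  have "real (floorlog 2 n) \<le> log 2 (real n) + 1"
    using assms by (simp add: floorlog_def)
  then show ?thesis by (simp add: num_symbols_encoding)
qed

lemma num_symbols_encoding_bigo: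
  "(\<lambda>n. real (num_symbols (encoding n))) \<in> O(\<lambda>n. ln (real n))"
proof -
  have "(\<lambda>n. real (num_symbols (encoding n))) \<in> O(\<lambda>n. 6 * log 2 (real n) + 10)"
    by (intro bigo_of_le num_symbols_encoding_le)
  also have "(\<lambda>n::nat. 6 * log 2 (real n) + 10) \<in> O(\<lambda>n. ln (real n))"
    by real_asymp
  finally show ?thesis .
qed

lemma pointer_bits_encoding_bigo:
  "(\<lambda>n. real (pointer_bits (encoding n))) \<in> O(\<lambda>n. ln (ln (real n)))"
proof -
  have le: "real (pointer_bits (encoding n)) \<le> log 2 (6 * log 2 (real n) + 10) + 1" if "n > 0" for n
  proof -
    define N where "N = 6 * floorlog 2 n + 4"
    have N: "N > 0" "real N \<le> 6 * log 2 (real n) + 10"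
      using num_symbols_encoding_le[OF that] by (simp_all add: N_def num_symbols_encoding)
    have "real (pointer_bits (encoding n)) = real (ceillog2 N)"
      by (simp add: pointer_bits_def num_symbols_encoding N_def)
    also have "\<dots> \<le> log 2 (real N) + 1"
      using N(1) of_int_ceiling_le_add_one[of "log 2 (real N)"] by (simp add: ceillog2_def)
    also have "log 2 (real N) \<le> log 2 (6 * log 2 (real n) + 10)"
      using N by (subst log_le_cancel_iff) auto
    finally show ?thesis by simp
  qed
  have "(\<lambda>n. real (pointer_bits (encoding n))) \<in> O(\<lambda>n. log 2 (6 * log 2 (real n) + 10) + 1)"
    by (intro bigo_of_le le)
  also have "(\<lambda>n::nat. log 2 (6 * log 2 (real n) + 10) + 1) \<in> O(\<lambda>n. ln (ln (real n)))"
    by real_asymp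
  finally show ?thesis .
qed

lemma length_dag_code_encoding_bigo:
  fixes cd :: "'f symbol \<Rightarrow> bool list"
  shows "(\<lambda>n. real (length (dag_code cd (encoding n)))) \<in> O(\<lambda>n. ln (real n) * ln (ln (real n)))"
proof -
  let ?w = "\<lambda>n. real (pointer_bits (encoding n :: 'f dag))"
  let ?N = "\<lambda>n. real (num_symbols (encoding n :: 'f dag))"
  obtain c where c: "\<And>n. length (dag_code cd (encoding n)) \<le>
    2 * pointer_bits (encoding n :: 'f dag) + 1 +
    num_symbols (encoding n :: 'f dag) * (c + 2 * pointer_bits (encoding n :: 'f dag))"
    using length_dag_code_encoding_le by blast
  have "real (length (dag_code cd (encoding n))) \<le> 2 * ?w n + 1 + ?N n * (real c + 2 * ?w n)" for n
    using of_nat_mono[OF c[of n], where ?'a = real] by simp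
  then have "(\<lambda>n. real (length (dag_code cd (encoding n)))) \<in>
      O(\<lambda>n. 2 * ?w n + 1 + ?N n * (real c + 2 * ?w n))"
    by (intro bigo_of_le)
  also have "(\<lambda>n. 2 * ?w n + 1 + ?N n * (real c + 2 * ?w n)) \<in> O(\<lambda>n. ln (real n) * ln (ln (real n)))"
  proof -
    have w: "(\<lambda>n. a + 2 * ?w n) \<in> O(\<lambda>n. ln (ln (real n)))" for a :: real
    proof (rule sum_in_bigo)
      show "(\<lambda>n::nat. a) \<in> O(\<lambda>n. ln (ln (real n)))" by real_asymp
      show "(\<lambda>n. 2 * ?w n) \<in> O(\<lambda>n. ln (ln (real n)))"
        using pointer_bits_encoding_bigo by simp
    qed
    have "(\<lambda>n. ?N n * (real c + 2 * ?w n)) \<in> O(\<lambda>n. ln (real n) * ln (ln (real n)))"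
      by (intro landau_o.big.mult num_symbols_encoding_bigo w)
    moreover have "(\<lambda>n. 2 * ?w n + 1) \<in> O(\<lambda>n. ln (real n) * ln (ln (real n)))"
    proof -
      have "(\<lambda>n. 2 * ?w n + 1) \<in> O(\<lambda>n. ln (ln (real n)))"
        using w[of 1] by (simp add: add.commute)
      also have "(\<lambda>n::nat. ln (ln (real n))) \<in> O(\<lambda>n. ln (real n) * ln (ln (real n)))"
        by real_asymp
      finally show ?thesis .
    qed
    ultimately show ?thesis by (intro sum_in_bigo(1)[of "\<lambda>n. 2 * ?w n + 1"])
  qed
  finally show ?thesis .
qed

theorem proposition7p1:
  fixes L :: "'f language"
  assumes "theta_language L"
  shows "\<exists>G :: nat \<Rightarrow> 'f dag.
    (\<forall>n. dag_term L (G n) \<and> encodes L (G n) n) \<and>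
    (\<lambda>n. real (num_symbols (G n))) \<in> O(\<lambda>n. ln (real n)) \<and>
    (\<lambda>n. real (pointer_bits (G n))) \<in> O(\<lambda>n. ln (ln (real n))) \<and>
    (\<forall>cd. symbol_code L cd \<longrightarrow>
       (\<lambda>n. real (length (dag_code cd (G n)))) \<in> O(\<lambda>n. ln (real n) * ln (ln (real n))))"
  using dag_term_encoding encodes_encoding num_symbols_encoding_bigo pointer_bits_encoding_bigo
    length_dag_code_encoding_bigo by blast

end
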